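(* Let $\alpha$ be a successor ordinal, and let $k\geq 2$ be a positive integer. \begin{enumerate} \item $R^{cl}(\alpha+1,k+1)\leq P^{cl}( R^{cl}(\alpha,k+1), R^{cl}(\alpha+1,k) )+1$. \item $R^{cl}(\alpha+1,k+1)\leq P^{cl}(R^{cl}(\alpha,k+1))_k+R^{cl}(\alpha+1,k)$. \end{enumerate}
   Context: All arithmetic operations on ordinals are in the ordinal sense. Every ordinal is identified with the set of smaller ordinals and carries the order topology; subsets carry the subspace topology. A set $X$ of ordinals is order-homeomorphic to an ordinal $\alpha$ (a closed copy of $\alpha$) if there is a bijection $X\to\alpha$ that is both an order-isomorphism and a homeomorphism; equivalently, $X$ is order-isomorphic to $\alpha$ and closed in its supremum. $[X]^2$ is the set of $2$-element subsets of $X$. $R^{cl}(\alpha,k)$ is the least ordinal $\beta$ such that for every coloring $c:[\beta]^2\to\{\text{red},\text{blue}\}$ either there is $X\subseteq\beta$ order-homeomorphic to $\alpha$ with all elements of $[X]^2$ red, or there is a $k$-element $Y\subseteq\beta$ with all elements of $[Y]^2$ blue. $P^{cl}(\alpha_1,\dots,\alpha_r)$ is the least ordinal $\beta$ such that for every coloring $c:\beta\to\{1,\dots,r\}$ there are $i$ and $X\subseteq c^{-1}(\{i\})$ order-homeomorphic to $\alpha_i$; $P^{cl}(\alpha)_k$ denotes $P^{cl}(\alpha,\dots,\alpha)$ with $k$ copies of $\alpha$. If no ordinal as required exists, the corresponding number is regarded as $\infty$, larger than every ordinal (and any expression involving it is $\infty$). *)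

theory Defs
  imports "HOL-Analysis.Analysis" "HOL-Library.Ramsey" "HOL-Library.Infinite_Typeclass"
begin

unbundle cardinal_syntax
no_notation elt_set_eq (infix \<open>=o\<close> 50)

text \<open>
  The type \<open>'a ordinal\<close> consists of the order types of all well-orders whose field is a set of
  elements of \<open>'a\<close>, that is, of all ordinals of cardinality at most \<open>|UNIV :: 'a set|\<close>.
  HOL has no single type containing all ordinals; the type variable \<open>'a\<close> plays the role of a
  universe, and every ordinal occurs in \<open>'a ordinal\<close> once \<open>'a\<close> is large enough. For infinite
  \<open>'a\<close> the type is closed under ordinal addition.
\<close>

quotient_type 'a ordinal = "'a rel" / partial: "\<lambda>r s. r =o s"
proof (rule part_equivpI)
  have "Well_order ({} :: 'a rel)"
    by (simp add: order_on_defs refl_on_def trans_def antisym_def total_on_def)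
  then have "({} :: 'a rel) =o ({} :: 'a rel)"
    by (rule ordIso_reflexive)
  then show "\<exists>r :: 'a rel. r =o r" by blast
  show "symp (\<lambda>r s :: 'a rel. r =o s)"
    by (simp add: sympI ordIso_symmetric)
  show "transp (\<lambda>r s :: 'a rel. r =o s)"
    by (rule transpI) (rule ordIso_transitive)
qed

lemma Well_order_rep_ordinal: "Well_order (rep_ordinal a)"
  using Quotient_rep_reflp[OF Quotient_ordinal] unfolding ordIso_def by blast

lemma rep_ordinal_ordIso_iff: "rep_ordinal a =o rep_ordinal b \<longleftrightarrow> a = b"
  using Quotient_rel_rep[OF Quotient_ordinal] by blast

lemma rep_abs_ordinal: "Well_order r \<Longrightarrow> rep_ordinal (abs_ordinal r) =o r"
  using Quotient_rep_abs[OF Quotient_ordinal] ordIso_reflexive by blast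

instantiation ordinal :: (type) wellorder
begin

definition less_eq_ordinal :: "'a ordinal \<Rightarrow> 'a ordinal \<Rightarrow> bool"
  where "a \<le> b \<longleftrightarrow> rep_ordinal a \<le>o rep_ordinal b"

definition less_ordinal :: "'a ordinal \<Rightarrow> 'a ordinal \<Rightarrow> bool"
  where "a < b \<longleftrightarrow> rep_ordinal a <o rep_ordinal b"

instance
proof
  fix a b c :: "'a ordinal"
  show "a < b \<longleftrightarrow> a \<le> b \<and> \<not> b \<le> a"
    unfolding less_eq_ordinal_def less_ordinal_def
    by (meson Well_order_rep_ordinal not_ordLeq_iff_ordLess ordLess_imp_ordLeq)
  show "a \<le> a"
    unfolding less_eq_ordinal_def by (simp add: Well_order_rep_ordinal ordLeq_reflexive)
  show "a \<le> b \<Longrightarrow> b \<le> c \<Longrightarrow> a \<le> c"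
    unfolding less_eq_ordinal_def by (rule ordLeq_transitive)
  show "a \<le> b \<Longrightarrow> b \<le> a \<Longrightarrow> a = b"
    unfolding less_eq_ordinal_def
    using ordIso_iff_ordLeq rep_ordinal_ordIso_iff by blast
  show "a \<le> b \<or> b \<le> a"
    unfolding less_eq_ordinal_def by (simp add: Well_order_rep_ordinal ordLeq_total)
next
  fix P :: "'a ordinal \<Rightarrow> bool" and a
  assume *: "\<And>x. (\<And>y. y < x \<Longrightarrow> P y) \<Longrightarrow> P x"
  have "wf (inv_image ordLess (rep_ordinal :: 'a ordinal \<Rightarrow> 'a rel))"
    by (rule wf_inv_image) (rule wf_ordLess)
  then show "P a"
  proof (induction a rule: wf_induct_rule)
    case (less x)
    show ?case by (rule *) (rule less, simp add: less_ordinal_def)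
  qed
qed

end

text \<open>
  The order topology. Since \<open>{..<\<beta>}\<close> is an initial segment, the order topology of the ordinal
  \<open>\<beta>\<close>, identified with \<open>{..<\<beta>}\<close>, is the subspace topology inherited from \<open>'a ordinal\<close>.
\<close>

instantiation ordinal :: (type) linorder_topology
begin

definition open_ordinal :: "'a ordinal set \<Rightarrow> bool"
  where "open_ordinal = generate_topology (range (\<lambda>a. {..<a}) \<union> range (\<lambda>a. {a<..}))"

instance
  by standard (rule open_ordinal_def)

end

definition ord_type :: "'b rel \<Rightarrow> 'a ordinal"
  where "ord_type r = (THE a. rep_ordinal a =o r)"

definition sum_rel :: "'a rel \<Rightarrow> 'b rel \<Rightarrow> ('a + 'b) rel"
  where "sum_rel r s =
    {(Inl x, Inl y) | x y. (x, y) \<in> r} \<union>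
    {(Inl x, Inr y) | x y. x \<in> Field r \<and> y \<in> Field s} \<union>
    {(Inr x, Inr y) | x y. (x, y) \<in> s}"

instantiation ordinal :: (type) "{one, plus}"
begin

definition one_ordinal :: "'a ordinal"
  where "1 = ord_type {((), ())}"

definition plus_ordinal :: "'a ordinal \<Rightarrow> 'a ordinal \<Rightarrow> 'a ordinal"
  where "a + b = ord_type (sum_rel (rep_ordinal a) (rep_ordinal b))"

instance ..

end

text \<open>
  The description in the definition of \<open>1\<close> is always met, and that in the definition of \<open>+\<close>
  is met for infinite \<open>'a\<close>.
\<close>

lemma rep_ord_type:
  fixes r :: "'b rel"
  assumes "Well_order r" and le: "|Field r| \<le>o |UNIV :: 'a set|"
  shows "rep_ordinal (ord_type r :: 'a ordinal) =o r"
proof -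
  obtain f :: "'b \<Rightarrow> 'a" where f: "inj_on f (Field r)"
    using le card_of_ordLeq[of "Field r" "UNIV :: 'a set"] by blast
  have "r =o dir_image r f"
    using dir_image_ordIso[OF assms(1) f] .
  moreover from this have "Well_order (dir_image r f)"
    unfolding ordIso_def by blast
  ultimately have "rep_ordinal (abs_ordinal (dir_image r f)) =o r"
    using rep_abs_ordinal ordIso_symmetric ordIso_transitive by blast
  then show ?thesis
    unfolding ord_type_def
    by (rule theI) (meson ordIso_symmetric ordIso_transitive rep_ordinal_ordIso_iff
        \<open>rep_ordinal (abs_ordinal (dir_image r f)) =o r\<close>)
qed

lemma Field_sum_rel: "Field (sum_rel r s) = Field r <+> Field s"
  by (auto simp: sum_rel_def Field_def Domain_iff Range_iff set_eq_iff split: sum.splits)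

lemma Well_order_sum_rel:
  assumes r: "Well_order r" and s: "Well_order s"
  shows "Well_order (sum_rel r s)"
proof -
  have props: "refl_on (Field r) r" "refl_on (Field s) s" "trans r" "trans s"
    "antisym r" "antisym s" "total_on (Field r) r" "total_on (Field s) s" "wf (r - Id)" "wf (s - Id)"
    using r s by (auto simp: order_on_defs)
  have fld: "x \<in> Field r \<and> y \<in> Field r" if "(x, y) \<in> r" for x y
    using that by (auto simp: Field_def)
  have flds: "x \<in> Field s \<and> y \<in> Field s" if "(x, y) \<in> s" for x y
    using that by (auto simp: Field_def)
  have "refl_on (Field (sum_rel r s)) (sum_rel r s)"
    using props(1,2) unfolding Field_sum_rel by (auto simp: refl_on_def sum_rel_def)
  moreover have "sum_rel r s \<subseteq> Field (sum_rel r s) \<times> Field (sum_rel r s)"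
    by (auto simp: Field_def)
  moreover have "trans (sum_rel r s)"
  proof (rule transI)
    fix x y z assume "(x, y) \<in> sum_rel r s" "(y, z) \<in> sum_rel r s"
    then show "(x, z) \<in> sum_rel r s"
      using props(3,4)[THEN transD] by (auto simp: sum_rel_def dest: fld flds)
  qed
  moreover have "antisym (sum_rel r s)"
    using props(5,6) by (auto simp: sum_rel_def antisym_def)
  moreover have "total_on (Field (sum_rel r s)) (sum_rel r s)"
    using props(7,8) unfolding Field_sum_rel total_on_def by (fastforce simp: sum_rel_def)
  moreover have "wf (sum_rel r s - Id)"
    unfolding wf_eq_minimal
  proof (intro allI impI)
    fix Q :: "('a + 'b) set" and z assume z: "z \<in> Q"
    show "\<exists>z\<in>Q. \<forall>y. (y, z) \<in> sum_rel r s - Id \<longrightarrow> y \<notin> Q"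
    proof (cases "\<exists>x. Inl x \<in> Q")
      case True
      then obtain x where "x \<in> Inl -` Q" by auto
      then obtain m where "m \<in> Inl -` Q" "\<forall>y. (y, m) \<in> r - Id \<longrightarrow> y \<notin> Inl -` Q"
        using props(9) unfolding wf_eq_minimal by meson
      then show ?thesis by (intro bexI[of _ "Inl m"]) (auto simp: sum_rel_def)
    next
      case False
      then obtain x where "x \<in> Inr -` Q" using z by (cases z) auto
      then obtain m where "m \<in> Inr -` Q" "\<forall>y. (y, m) \<in> s - Id \<longrightarrow> y \<notin> Inr -` Q"
        using props(10) unfolding wf_eq_minimal by meson
      then show ?thesis using False by (intro bexI[of _ "Inr m"]) (auto simp: sum_rel_def)
    qed
  qed
  ultimately show ?thesis
    by (simp add: order_on_defs)
qed

lemma rep_ordinal_one: "rep_ordinal (1 :: 'a ordinal) =o {((), ())}"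
  unfolding one_ordinal_def
proof (rule rep_ord_type)
  show "Well_order {((), ())}"
    by (auto simp: order_on_defs refl_on_def trans_def antisym_def total_on_def Field_def)
  show "|Field {((), ())}| \<le>o |UNIV :: 'a set|"
    by (rule card_of_ordLeqI[where f = "\<lambda>_. undefined"]) (auto simp: Field_def)
qed

lemma rep_ordinal_plus:
  fixes a b :: "'a::infinite ordinal"
  shows "rep_ordinal (a + b) =o sum_rel (rep_ordinal a) (rep_ordinal b)"
  unfolding plus_ordinal_def
proof (rule rep_ord_type)
  show "Well_order (sum_rel (rep_ordinal a) (rep_ordinal b))"
    by (intro Well_order_sum_rel Well_order_rep_ordinal)
  have "|Field (rep_ordinal a) <+> Field (rep_ordinal b)| \<le>o |(UNIV :: 'a set) <+> (UNIV :: 'a set)|"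
    by (intro card_of_mono1) auto
  also have "|(UNIV :: 'a set) <+> (UNIV :: 'a set)| =o |UNIV :: 'a set|"
    by (rule card_of_Plus_infinite1) (simp_all add: infinite_UNIV card_of_mono1)
  finally show "|Field (sum_rel (rep_ordinal a) (rep_ordinal b))| \<le>o |UNIV :: 'a set|"
    by (simp add: Field_sum_rel)
qed

datatype 'a ext_ordinal = Ord (the_ord: "'a ordinal") | Infty (\<open>\<infinity>\<^sub>o\<close>)

instantiation ext_ordinal :: (type) "{linorder, one, plus}"
begin

fun less_eq_ext_ordinal :: "'a ext_ordinal \<Rightarrow> 'a ext_ordinal \<Rightarrow> bool" where
  "x \<le> \<infinity>\<^sub>o \<longleftrightarrow> True"
| "Ord a \<le> Ord b \<longleftrightarrow> a \<le> b"
| "\<infinity>\<^sub>o \<le> Ord b \<longleftrightarrow> False"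

definition less_ext_ordinal :: "'a ext_ordinal \<Rightarrow> 'a ext_ordinal \<Rightarrow> bool"
  where "x < y \<longleftrightarrow> x \<le> y \<and> \<not> y \<le> x" for x y :: "'a ext_ordinal"

definition one_ext_ordinal :: "'a ext_ordinal"
  where "1 = Ord 1"

fun plus_ext_ordinal :: "'a ext_ordinal \<Rightarrow> 'a ext_ordinal \<Rightarrow> 'a ext_ordinal" where
  "Ord a + Ord b = Ord (a + b)"
| "\<infinity>\<^sub>o + y = \<infinity>\<^sub>o"
| "x + \<infinity>\<^sub>o = \<infinity>\<^sub>o"

instance
proof
  fix x y z :: "'a ext_ordinal"
  show "x < y \<longleftrightarrow> x \<le> y \<and> \<not> y \<le> x" by (rule less_ext_ordinal_def)
  show "x \<le> x" by (cases x) auto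
  show "x \<le> y \<Longrightarrow> y \<le> z \<Longrightarrow> x \<le> z" by (cases x; cases y; cases z) auto
  show "x \<le> y \<Longrightarrow> y \<le> x \<Longrightarrow> x = y" by (cases x; cases y) auto
  show "x \<le> y \<or> y \<le> x" by (cases x; cases y) auto
qed

end

text \<open>
  Infinity means that no ordinal in the universe \<open>'a ordinal\<close> has the property. If some ordinal
  has it, then the least such ordinal does not depend on the choice of a sufficiently large \<open>'a\<close>.
\<close>

definition least_ordinal :: "('a ordinal \<Rightarrow> bool) \<Rightarrow> 'a ext_ordinal"
  where "least_ordinal Q = (if \<exists>\<beta>. Q \<beta> then Ord (LEAST \<beta>. Q \<beta>) else \<infinity>\<^sub>o)"

definition order_homeomorphic :: "'a ordinal set \<Rightarrow> 'a ordinal \<Rightarrow> bool"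
  where "order_homeomorphic X \<alpha> \<longleftrightarrow>
    (\<exists>f g. homeomorphism X {..<\<alpha>} f g \<and> strict_mono_on X f)"

datatype colour = Red | Blue

definition Rcl :: "'a ordinal \<Rightarrow> nat \<Rightarrow> 'a ext_ordinal"
  where "Rcl \<alpha> k = least_ordinal (\<lambda>\<beta>. \<forall>c :: 'a ordinal set \<Rightarrow> colour.
    (\<exists>X \<subseteq> {..<\<beta>}. order_homeomorphic X \<alpha> \<and> (\<forall>e \<in> [X]\<^bsup>2\<^esup>. c e = Red)) \<or>
    (\<exists>Y \<in> [{..<\<beta>}]\<^bsup>k\<^esup>. \<forall>e \<in> [Y]\<^bsup>2\<^esup>. c e = Blue))"

definition Pcl :: "'a ordinal list \<Rightarrow> 'a ext_ordinal"
  where "Pcl \<alpha>s = least_ordinal (\<lambda>\<beta>. \<forall>c :: 'a ordinal \<Rightarrow> nat.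
    c \<in> {..<\<beta>} \<rightarrow> {..<length \<alpha>s} \<longrightarrow>
    (\<exists>i < length \<alpha>s. \<exists>X \<subseteq> {\<delta> \<in> {..<\<beta>}. c \<delta> = i}. order_homeomorphic X (\<alpha>s ! i)))"

text \<open>
  The convention that an expression with an infinite argument is infinite takes precedence even
  over a zero argument, for which the number would otherwise be zero.
\<close>

definition Pcl_ext :: "'a ext_ordinal list \<Rightarrow> 'a ext_ordinal"
  where "Pcl_ext xs = (if \<infinity>\<^sub>o \<in> set xs then \<infinity>\<^sub>o else Pcl (map the_ord xs))"

abbreviation Pcl_const :: "'a ext_ordinal \<Rightarrow> nat \<Rightarrow> 'a ext_ordinal"
  where "Pcl_const x k \<equiv> Pcl_ext (replicate k x)"

definition successor_ordinal :: "'a ordinal \<Rightarrow> bool"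
  where "successor_ordinal \<alpha> \<longleftrightarrow> (\<exists>\<gamma>. \<alpha> = \<gamma> + 1)"

end

theory Submission
  imports Defs
begin

text \<open>
  Say that a set \<open>S\<close> of ordinals \<^emph>\<open>arrows\<close> \<open>(\<alpha>, k)\<close> if every colouring of its pairs admits a closed
  red copy of \<open>\<alpha>\<close> or a blue \<open>k\<close>-clique inside \<open>S\<close>. This property passes from an ordinal to its
  closed copies (\<open>arrows_closed_copy\<close>), so it may be applied inside monochromatic closed
  copies supplied by the pigeonhole number.

  For the first inequality let \<open>P\<close> be the pigeonhole number. The ordinal \<open>P + 1\<close> is \<open>P\<close> with a top
  point; colour each \<open>\<delta> < P\<close> by the colour of the pair formed by \<open>\<delta>\<close> and the top. Inside a
  closed copy of \<open>R(\<alpha>, k + 1)\<close> all red to the top there is a blue \<open>(k + 1)\<close>-clique or a red closed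
  copy of \<open>\<alpha>\<close>, and in the second case adding the top gives a red closed copy of \<open>\<alpha> + 1\<close>. Inside a
  closed copy of \<open>R(\<alpha> + 1, k)\<close> all blue to the top there is a red closed copy of \<open>\<alpha> + 1\<close> or a blue
  \<open>k\<close>-clique, which the top extends.

  For the second inequality split \<open>P + \<sigma>\<close>, where \<open>\<sigma> = R(\<alpha> + 1, k)\<close>, into the initial segment \<open>P\<close> and
  the tail. The tail is a closed copy of \<open>\<sigma>\<close> (\<open>order_homeomorphic_tail\<close>), so it may be assumed to
  contain a blue \<open>k\<close>-clique \<open>Y\<close>. A point below \<open>P\<close> that is blue to all of \<open>Y\<close> completes a blue
  \<open>(k + 1)\<close>-clique. Otherwise colour each point below \<open>P\<close> by (the index of) a member of \<open>Y\<close>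
  to which it is red: with \<open>k\<close> colours the pigeonhole number gives a closed copy of \<open>R(\<alpha>, k + 1)\<close>
  all red to one member of \<open>Y\<close>, and that member plays the role of the top point above.

  That \<open>\<alpha>\<close> is a successor is what makes a new top point harmless: a closed copy \<open>Z\<close> of \<open>\<alpha>\<close> then has
  a maximum, so any point above \<open>Z\<close> is isolated from it, just as the last point of \<open>\<alpha> + 1\<close> is
  (\<open>order_homeomorphic_insert_top\<close>).
\<close>

section \<open>Addition of ordinals as concatenation of intervals\<close>

lemma ordinal_enumerates_initial_segment:
  fixes \<beta> :: "'a ordinal" and s :: "'b rel"
  assumes "rep_ordinal \<beta> =o s"
  obtains e where "\<And>x y. (x, y) \<in> s \<Longrightarrow> x \<noteq> y \<Longrightarrow> e x < e y" and "e ` Field s = {..<\<beta>}"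
proof -
  define r where "r = rep_ordinal \<beta>"
  have W: "Well_order r" unfolding r_def by (rule Well_order_rep_ordinal)
  then have wo: "wo_rel r" by (simp add: wo_rel_def)
  \<comment> \<open>Each point of a well-order is sent to the order type of the points strictly below it.\<close>
  define E where "E x = (abs_ordinal (Restr r (underS r x)) :: 'a ordinal)" for x
  have rep_E: "rep_ordinal (E x) =o Restr r (underS r x)" for x
    unfolding E_def by (rule rep_abs_ordinal) (rule Well_order_Restr[OF W])
  have E_mono: "E x < E y" if "(x, y) \<in> r" "x \<noteq> y" for x y
  proof -
    have "underS r x \<subset> underS r y"
      using that W unfolding underS_def order_on_defs antisym_def trans_def by blast
    then have "Restr r (underS r x) <o Restr r (underS r y)"
      using ofilter_subset_ordLess[OF W] wo_rel.underS_ofilter[OF wo] by blast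
    then show ?thesis
      using rep_E[of x] ordIso_symmetric[OF rep_E[of y]]
        ordIso_ordLess_trans ordLess_ordIso_trans unfolding less_ordinal_def by blast
  qed
  have E_image: "E ` Field r = {..<\<beta>}"
  proof (intro equalityI subsetI)
    fix a assume "a \<in> E ` Field r"
    then obtain x where x: "x \<in> Field r" "a = E x" by blast
    then have "Restr r (underS r x) <o r" using underS_Restr_ordLess[OF W] by blast
    then show "a \<in> {..<\<beta>}"
      using rep_E[of x] ordIso_ordLess_trans x by (auto simp: less_ordinal_def r_def)
  next
    fix a assume "a \<in> {..<\<beta>}"
    then have "rep_ordinal a <o r" by (simp add: less_ordinal_def r_def)
    then obtain x where x: "x \<in> Field r" "rep_ordinal a =o Restr r (underS r x)"
      using ordLess_iff_ordIso_Restr[OF W Well_order_rep_ordinal] by blast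
    then have "rep_ordinal a =o rep_ordinal (E x)"
      using rep_E ordIso_symmetric ordIso_transitive by blast
    then show "a \<in> E ` Field r"
      using x(1) by (auto simp: rep_ordinal_ordIso_iff)
  qed
  have "s =o r" using assms by (simp add: r_def ordIso_symmetric)
  then obtain f where f: "bij_betw f (Field s) (Field r)"
    "\<And>a b. a \<in> Field s \<Longrightarrow> b \<in> Field s \<Longrightarrow> (a, b) \<in> s \<longleftrightarrow> (f a, f b) \<in> r"
    unfolding ordIso_def iso_iff2 by blast
  show ?thesis
  proof (rule that[of "E \<circ> f"])
    fix x y assume xy: "(x, y) \<in> s" "x \<noteq> y"
    then have "x \<in> Field s" "y \<in> Field s" by (auto simp: Field_def)
    then show "(E \<circ> f) x < (E \<circ> f) y"
      using f xy E_mono[of "f x" "f y"] by (auto simp: bij_betw_def inj_on_def)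
  next
    show "(E \<circ> f) ` Field s = {..<\<beta>}"
      using f(1) E_image by (metis bij_betw_imp_surj_on image_comp)
  qed
qed

lemma strict_mono_on_initial_segment_increasing:
  fixes a :: "'a::wellorder"
  assumes f: "strict_mono_on {..<a} f" and into: "f ` {..<a} \<subseteq> {..<a}" and "x < a"
  shows "x \<le> f x"
  using \<open>x < a\<close>
proof (induction x rule: less_induct)
  case (less x)
  show ?case
  proof (rule ccontr)
    assume "\<not> x \<le> f x"
    then have "f x < x" by simp
    moreover from this have "f (f x) < f x"
      using less.prems strict_mono_onD[OF f, of "f x" x] by auto
    \<comment> \<open>So \<open>f x\<close> would be a smaller counterexample.\<close>
    ultimately show False
      using less by (meson leD order.strict_trans)
  qed
qed

lemma strict_mono_on_initial_segment_le:
  fixes a :: "'a::wellorder"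
  assumes "strict_mono_on {..<a} f" and "f ` {..<a} \<subseteq> {..<b}"
  shows "a \<le> b"
proof (rule ccontr)
  assume "\<not> a \<le> b"
  then have "b < a" by simp
  then have "f ` {..<a} \<subseteq> {..<a}" using assms(2) by auto
  then have "b \<le> f b"
    using strict_mono_on_initial_segment_increasing[OF assms(1)] \<open>b < a\<close> by blast
  then show False using assms(2) \<open>b < a\<close> by auto
qed

lemma strict_mono_on_inverse:
  fixes f :: "'a::linorder \<Rightarrow> 'b::linorder"
  assumes "strict_mono_on A f"
  shows "strict_mono_on (f ` A) (the_inv_into A f)"
proof -
  have inj: "inj_on f A" using assms by (rule strict_mono_on_imp_inj_on)
  show ?thesis
  proof (rule strict_mono_onI)
    fix u v assume "u \<in> f ` A" "v \<in> f ` A" "u < v"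
    then obtain x y where xy: "x \<in> A" "y \<in> A" "u = f x" "v = f y" by blast
    then have "x < y"
      using \<open>u < v\<close> assms by (metis linorder_neqE less_asym strict_mono_onD less_irrefl)
    then show "the_inv_into A f u < the_inv_into A f v"
      using xy inj by (simp add: the_inv_into_f_f)
  qed
qed

text \<open>
  A function that is increasing along the representing well-order of \<open>c\<close> becomes, after reindexing,
  an increasing function on the ordinal \<open>c\<close> itself.
\<close>

lemma reindex_rep_ordinal:
  fixes c :: "'a ordinal" and \<phi> :: "'a \<Rightarrow> 'b::linorder"
  assumes \<phi>: "\<And>x y. (x, y) \<in> rep_ordinal c \<Longrightarrow> x \<noteq> y \<Longrightarrow> \<phi> x < \<phi> y"
  obtains w where "strict_mono_on {..<c} w" and "w ` {..<c} = \<phi> ` Field (rep_ordinal c)"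
proof -
  let ?F = "Field (rep_ordinal c)"
  obtain p where p: "\<And>x y. (x, y) \<in> rep_ordinal c \<Longrightarrow> x \<noteq> y \<Longrightarrow> p x < p y" and p_im: "p ` ?F = {..<c}"
    using ordinal_enumerates_initial_segment[OF ordIso_reflexive[OF Well_order_rep_ordinal]] by blast
  have total: "(x, y) \<in> rep_ordinal c \<or> (y, x) \<in> rep_ordinal c" if "x \<in> ?F" "y \<in> ?F" for x y
    using that wo_rel.TOTALS[of "rep_ordinal c"] Well_order_rep_ordinal[of c]
    by (auto simp: wo_rel_def)
  have inj: "inj_on p ?F"
    using p total by (metis inj_onI less_irrefl)
  define q where "q = the_inv_into ?F p"
  have q: "q ` {..<c} = ?F"
    unfolding q_def p_im[symmetric] by (rule the_inv_into_onto[OF inj])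
  have pq: "p (q z) = z" if "z \<in> {..<c}" for z
    unfolding q_def using inj p_im that by (simp add: f_the_inv_into_f)
  show ?thesis
  proof (rule that[of "\<phi> \<circ> q"])
    show "strict_mono_on {..<c} (\<phi> \<circ> q)"
    proof (rule strict_mono_onI)
      fix x y assume xy: "x \<in> {..<c}" "y \<in> {..<c}" "x < y"
      have "q x \<in> ?F" "q y \<in> ?F" using q xy by blast+
      then have "(q x, q y) \<in> rep_ordinal c \<or> (q y, q x) \<in> rep_ordinal c" by (rule total)
      moreover have "p (q x) < p (q y)" using pq xy by simp
      ultimately have "(q x, q y) \<in> rep_ordinal c" "q x \<noteq> q y"
        using p[of "q y" "q x"] by (metis less_asym less_irrefl)+
      then show "(\<phi> \<circ> q) x < (\<phi> \<circ> q) y" using \<phi> by simp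
    qed
    show "(\<phi> \<circ> q) ` {..<c} = \<phi> ` ?F"
      using q by (metis image_comp)
  qed
qed

text \<open>
  The enumeration of \<open>a + b\<close> lists the left summand first. The part it lists is an initial
  segment of order type \<open>a\<close>, hence is \<open>a\<close>, and what remains is the tail.
\<close>

lemma tail_of_ordinal_sum:
  fixes a b :: "'a::infinite ordinal"
  obtains h :: "'a ordinal \<Rightarrow> 'a ordinal"
    where "strict_mono_on {..<b} h" and "h ` {..<b} = {a..<a + b}" and "a \<le> a + b"
proof -
  define A where "A = Field (rep_ordinal a)"
  define B where "B = Field (rep_ordinal b)"
  obtain e where e: "\<And>x y. (x, y) \<in> sum_rel (rep_ordinal a) (rep_ordinal b) \<Longrightarrow> x \<noteq> y \<Longrightarrow> e x < e y"
    and e_im: "e ` (A <+> B) = {..<a + b}"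
    using ordinal_enumerates_initial_segment[OF rep_ordinal_plus[of a b]]
    unfolding Field_sum_rel A_def B_def by blast
  have e_Inl: "(e \<circ> Inl) x < (e \<circ> Inl) y" if "(x, y) \<in> rep_ordinal a" "x \<noteq> y" for x y
    using that e[of "Inl x" "Inl y"] by (simp add: sum_rel_def)
  have e_Inr: "(e \<circ> Inr) x < (e \<circ> Inr) y" if "(x, y) \<in> rep_ordinal b" "x \<noteq> y" for x y
    using that e[of "Inr x" "Inr y"] by (simp add: sum_rel_def)
  obtain f where f: "strict_mono_on {..<a} f" "f ` {..<a} = (e \<circ> Inl) ` A"
    using reindex_rep_ordinal[of a "e \<circ> Inl", OF e_Inl] unfolding A_def by blast
  obtain h where h: "strict_mono_on {..<b} h" "h ` {..<b} = (e \<circ> Inr) ` B"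
    using reindex_rep_ordinal[of b "e \<circ> Inr", OF e_Inr] unfolding B_def by blast
  have split: "{..<a + b} = f ` {..<a} \<union> h ` {..<b}"
    unfolding e_im[symmetric] f(2) h(2) by (auto simp: Plus_def)
  have below: "x < y" if "x \<in> f ` {..<a}" "y \<in> h ` {..<b}" for x y
    using that e unfolding f(2) h(2) A_def B_def by (auto simp: sum_rel_def)
  \<comment> \<open>\<open>m\<close> is where the left summand ends; it is shown to be \<open>a\<close>.\<close>
  define m where "m = (LEAST z. z \<notin> f ` {..<a})"
  have m_out: "m \<notin> f ` {..<a}"
    unfolding m_def
  proof (rule LeastI)
    show "a + b \<notin> f ` {..<a}" using split by blast
  qed
  have "f ` {..<a} = {..<m}"
  proof (intro equalityI subsetI)
    fix z assume z: "z \<in> f ` {..<a}"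
    show "z \<in> {..<m}"
    proof (rule ccontr)
      assume "z \<notin> {..<m}"
      then have "m < z" using z m_out by (metis lessThan_iff linorder_neqE)
      moreover have "z < a + b" using z split by blast
      ultimately have "m \<in> {..<a + b}" by simp
      then have "m \<in> h ` {..<b}" using split m_out by blast
      then show False using below[OF z] \<open>m < z\<close> less_asym by blast
    qed
  next
    fix z assume "z \<in> {..<m}"
    then show "z \<in> f ` {..<a}" using not_less_Least unfolding m_def by blast
  qed
  have "a \<le> m"
    using strict_mono_on_initial_segment_le[OF f(1)] \<open>f ` {..<a} = {..<m}\<close> by simp
  moreover have "m \<le> a"
  proof (rule strict_mono_on_initial_segment_le)
    show "strict_mono_on {..<m} (the_inv_into {..<a} f)"
      using strict_mono_on_inverse[OF f(1)] \<open>f ` {..<a} = {..<m}\<close> by simp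
    show "the_inv_into {..<a} f ` {..<m} \<subseteq> {..<a}"
      using the_inv_into_onto[OF strict_mono_on_imp_inj_on[OF f(1)]] \<open>f ` {..<a} = {..<m}\<close> by simp
  qed
  ultimately have fa: "f ` {..<a} = {..<a}" using \<open>f ` {..<a} = {..<m}\<close> by simp
  have "h ` {..<b} = {a..<a + b}"
  proof (intro equalityI subsetI)
    fix z assume z: "z \<in> h ` {..<b}"
    then have "z \<notin> {..<a}" using below[of z z] fa by blast
    then show "z \<in> {a..<a + b}" using z split by auto
  next
    fix z assume "z \<in> {a..<a + b}"
    then have "z \<in> {..<a + b}" and "z \<notin> {..<a}" by auto
    then have "z \<in> f ` {..<a} \<union> h ` {..<b}" and "z \<notin> f ` {..<a}"
      unfolding split fa by blast+
    then show "z \<in> h ` {..<b}" by blast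
  qed
  moreover have "a \<le> a + b"
  proof (rule ccontr)
    assume "\<not> a \<le> a + b"
    then have "a + b \<in> f ` {..<a}" using fa by simp
    then show False using split by blast
  qed
  ultimately show ?thesis using that h(1) by blast
qed

lemma less_ordinal_succ: "a < a + 1" and lessThan_ordinal_succ: "{..<a + 1} = insert a {..<a}"
  for a :: "'a::infinite ordinal"
proof -
  obtain e where "e ` Field {((), ())} = {..<1 :: 'a ordinal}"
    using ordinal_enumerates_initial_segment[OF rep_ordinal_one] by metis
  then obtain z where "{..<1 :: 'a ordinal} = {z}" by (auto simp: Field_def)
  moreover obtain h :: "'a ordinal \<Rightarrow> 'a ordinal"
    where "h ` {..<1} = {a..<a + 1}" and le: "a \<le> a + 1"
    using tail_of_ordinal_sum[of 1 a] by blast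
  ultimately have tail: "{a..<a + 1} = {h z}" by auto
  then have "h z \<in> {a..<a + 1}" by blast
  then show "a < a + 1" by auto
  then have "a \<in> {a..<a + 1}" by simp
  then have "{a..<a + 1} = {a}" using tail by (metis singletonD)
  then show "{..<a + 1} = insert a {..<a}"
    using le ivl_disj_un_one(2)[OF le] by auto
qed

section \<open>Closed copies\<close>

text \<open>
  The order topology of a linear order need not restrict to the order topology of a subset, but it
  does on a convex subset. Accordingly, under an increasing map onto a convex set the preimage of an
  open ray is again an open ray of the domain, or the whole domain, or empty.
\<close>

lemma strict_mono_on_convex_image_continuous:
  fixes f :: "'a::linorder_topology \<Rightarrow> 'b::linorder_topology"
  assumes f: "strict_mono_on A f"
    and conv: "\<And>x y. x \<in> f ` A \<Longrightarrow> y \<in> f ` A \<Longrightarrow> {x..y} \<subseteq> f ` A"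
  shows "continuous_on A f"
proof (rule continuous_on_generate_topology[OF open_generated_order])
  have less_iff: "f x < f y \<longleftrightarrow> x < y" if "x \<in> A" "y \<in> A" for x y
    using that f by (metis linorder_neqE less_asym strict_mono_onD less_irrefl)
  fix B :: "'b set"
  assume "B \<in> range (\<lambda>a. {..<a}) \<union> range (\<lambda>a. {a<..})"
  then obtain b where B: "B = {..<b} \<or> B = {b<..}" by blast
  show "\<exists>C. open C \<and> C \<inter> A = f -` B \<inter> A"
  proof (cases "b \<in> f ` A")
    case True
    then obtain a where a: "a \<in> A" "b = f a" by blast
    from B show ?thesis
    proof
      assume "B = {..<b}"
      then show ?thesis using a less_iff by (intro exI[of _ "{..<a}"]) auto
    next
      assume "B = {b<..}"
      then show ?thesis using a less_iff by (intro exI[of _ "{a<..}"]) auto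
    qed
  next
    case False
    \<comment> \<open>By convexity \<open>b\<close> lies on one side of the whole image.\<close>
    have "f ` A \<subseteq> {..<b} \<or> f ` A \<subseteq> {b<..}"
    proof (rule ccontr)
      assume "\<not> (f ` A \<subseteq> {..<b} \<or> f ` A \<subseteq> {b<..})"
      then obtain u v where "u \<in> f ` A" "v \<in> f ` A" "v \<le> b" "b \<le> u"
        by (metis greaterThan_iff lessThan_iff linorder_not_less subsetI)
      then show False using conv[of v u] False by auto
    qed
    then have "f -` B \<inter> A = A \<or> f -` B \<inter> A = {}"
      using B by fastforce
    then show ?thesis
      by (metis Int_UNIV_left Int_empty_left open_UNIV open_empty)
  qed
qed

lemma order_homeomorphic_convex:
  assumes h: "strict_mono_on {..<\<beta>} h" and im: "h ` {..<\<beta>} = A"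
    and conv: "\<And>x y. x \<in> A \<Longrightarrow> y \<in> A \<Longrightarrow> {x..y} \<subseteq> A"
  shows "order_homeomorphic A \<beta>"
proof -
  let ?g = "the_inv_into {..<\<beta>} h"
  have inj: "inj_on h {..<\<beta>}" using h by (rule strict_mono_on_imp_inj_on)
  have mono: "strict_mono_on A ?g" using strict_mono_on_inverse[OF h] im by simp
  have im': "?g ` A = {..<\<beta>}" using the_inv_into_onto[OF inj] im by simp
  have "continuous_on A ?g"
    by (rule strict_mono_on_convex_image_continuous[OF mono]) (auto simp: im')
  moreover have "continuous_on {..<\<beta>} h"
    by (rule strict_mono_on_convex_image_continuous[OF h]) (use conv im in blast)
  ultimately have "homeomorphism A {..<\<beta>} ?g h"
    unfolding homeomorphism_def using inj im im'
    by (auto simp: the_inv_into_f_f f_the_inv_into_f)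
  then show ?thesis
    unfolding order_homeomorphic_def using mono by blast
qed

lemma order_homeomorphic_tail:
  fixes a b :: "'a::infinite ordinal"
  shows "order_homeomorphic {a..<a + b} b"
proof -
  obtain h where h: "strict_mono_on {..<b} h" "h ` {..<b} = {a..<a + b}"
    using tail_of_ordinal_sum[of b a] by metis
  then show ?thesis by (rule order_homeomorphic_convex) auto
qed

text \<open>
  The maximum \<open>z\<close> of \<open>Z\<close> separates \<open>Z\<close> from \<open>y\<close>, so both pieces are closed in \<open>insert y Z\<close>, and the
  same holds for the two pieces \<open>{..<\<alpha>}\<close> and \<open>{\<alpha>}\<close> of \<open>\<alpha> + 1\<close>; hence the given maps extend
  continuously. If \<open>Z\<close> had no maximum, this would require \<open>y\<close> to be the supremum of \<open>Z\<close>.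
\<close>

lemma order_homeomorphic_insert_top:
  fixes \<alpha> :: "'a::infinite ordinal"
  assumes suc: "successor_ordinal \<alpha>" and Z: "order_homeomorphic Z \<alpha>" and top: "Z \<subseteq> {..<y}"
  shows "order_homeomorphic (insert y Z) (\<alpha> + 1)"
proof -
  obtain \<gamma> where \<gamma>: "\<alpha> = \<gamma> + 1" using suc unfolding successor_ordinal_def by blast
  obtain f g where hom: "homeomorphism Z {..<\<alpha>} f g" and mono: "strict_mono_on Z f"
    using Z unfolding order_homeomorphic_def by blast
  have fg: "f ` Z = {..<\<alpha>}" "g ` {..<\<alpha>} = Z" "\<And>x. x \<in> Z \<Longrightarrow> g (f x) = x"
    "\<And>x. x < \<alpha> \<Longrightarrow> f (g x) = x" "continuous_on Z f" "continuous_on {..<\<alpha>} g"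
    using hom unfolding homeomorphism_def by blast+
  have \<gamma>\<alpha>: "\<gamma> < \<alpha>" "{..<\<alpha>} = insert \<gamma> {..<\<gamma>}"
    using \<gamma> less_ordinal_succ lessThan_ordinal_succ by auto
  define z where "z = g \<gamma>"
  have zZ: "z \<in> Z" using fg(2) \<gamma>\<alpha>(1) unfolding z_def by blast
  have z_max: "x \<le> z" if "x \<in> Z" for x
  proof (rule ccontr)
    assume "\<not> x \<le> z"
    then have "f z < f x" using strict_mono_onD[OF mono zZ that] by simp
    then have "\<gamma> < f x" unfolding z_def fg(4)[OF \<gamma>\<alpha>(1)] .
    moreover have "f x \<in> insert \<gamma> {..<\<gamma>}" using that fg(1) \<gamma>\<alpha>(2) by blast
    ultimately show False by auto
  qed
  have "z < y" "y \<notin> Z" using top zZ by auto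
  have closed_pair: "closedin (top_of_set (S \<union> {t})) S \<and> closedin (top_of_set (S \<union> {t})) {t}"
    if "S \<subseteq> {..m}" "m < t" for S and m t :: "'a ordinal"
  proof -
    have "(S \<union> {t}) \<inter> {..m} = S" "(S \<union> {t}) \<inter> {t} = {t}" using that by auto
    then show ?thesis
      using closedin_closed_Int[OF closed_atMost, of "S \<union> {t}" m]
        closedin_closed_Int[OF closed_singleton, of "S \<union> {t}" t] by simp
  qed
  let ?f = "\<lambda>x. if x = y then \<alpha> else f x"
  let ?g = "\<lambda>x. if x = \<alpha> then y else g x"
  have Z_closed: "closedin (top_of_set (Z \<union> {y})) Z \<and> closedin (top_of_set (Z \<union> {y})) {y}"
    by (rule closed_pair[of Z z]) (use z_max \<open>z < y\<close> in blast)+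
  have "{..<\<alpha>} \<subseteq> {..\<gamma>}" unfolding \<gamma>\<alpha>(2) by auto
  then have \<alpha>_closed: "closedin (top_of_set ({..<\<alpha>} \<union> {\<alpha>})) {..<\<alpha>} \<and>
      closedin (top_of_set ({..<\<alpha>} \<union> {\<alpha>})) {\<alpha>}"
    using \<gamma>\<alpha>(1) by (rule closed_pair)
  have f_cont: "continuous_on (Z \<union> {y}) ?f"
  proof (rule continuous_on_Un_local)
    show "continuous_on Z ?f"
      using fg(5) by (rule continuous_on_eq) (use \<open>y \<notin> Z\<close> in auto)
  qed (simp_all only: Z_closed continuous_on_sing)
  have g_cont: "continuous_on ({..<\<alpha>} \<union> {\<alpha>}) ?g"
  proof (rule continuous_on_Un_local)
    show "continuous_on {..<\<alpha>} ?g"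
      using fg(6) by (rule continuous_on_eq) auto
  qed (simp_all only: \<alpha>_closed continuous_on_sing)
  have "strict_mono_on (insert y Z) ?f"
  proof (rule strict_mono_onI)
    fix u v assume uv: "u \<in> insert y Z" "v \<in> insert y Z" "u < v"
    have "u \<noteq> y" using uv top by auto
    then have u: "u \<in> Z" using uv by blast
    then have "f u < \<alpha>" using fg(1) by blast
    then show "?f u < ?f v"
      using uv strict_mono_onD[OF mono u, of v] \<open>u \<noteq> y\<close> by (cases "v = y") simp_all
  qed
  moreover have "homeomorphism (insert y Z) {..<\<alpha> + 1} ?f ?g"
  proof (rule homeomorphismI)
    show "continuous_on (insert y Z) ?f" "continuous_on {..<\<alpha> + 1} ?g"
      using f_cont g_cont by (simp_all add: lessThan_ordinal_succ)
    have "?f x \<in> insert \<alpha> {..<\<alpha>}" if "x \<in> insert y Z" for x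
      using that fg(1) by (cases "x = y") auto
    then show "?f ` insert y Z \<subseteq> {..<\<alpha> + 1}" unfolding lessThan_ordinal_succ by blast
    have "?g x \<in> insert y Z" if "x \<in> insert \<alpha> {..<\<alpha>}" for x
      using that fg(2) by (cases "x = \<alpha>") auto
    then show "?g ` {..<\<alpha> + 1} \<subseteq> insert y Z" unfolding lessThan_ordinal_succ by blast
    show "?g (?f x) = x" if "x \<in> insert y Z" for x
    proof (cases "x = y")
      case False
      then have "x \<in> Z" using that by blast
      moreover from this have "f x < \<alpha>" using fg(1) by blast
      ultimately show ?thesis using False fg(3)[of x] by simp
    qed auto
    show "?f (?g x) = x" if "x \<in> {..<\<alpha> + 1}" for x
    proof (cases "x = \<alpha>")
      case False
      then have "x < \<alpha>" using that unfolding lessThan_ordinal_succ by auto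
      then have "g x \<in> Z" using fg(2) by blast
      then have "g x \<noteq> y" using \<open>y \<notin> Z\<close> by blast
      then show ?thesis using False fg(4)[OF \<open>x < \<alpha>\<close>] by simp
    qed auto
  qed
  ultimately show ?thesis unfolding order_homeomorphic_def by blast
qed

section \<open>Arrow relations on sets of ordinals\<close>

definition arrows :: "'a ordinal set \<Rightarrow> 'a ordinal \<Rightarrow> nat \<Rightarrow> bool"
  where "arrows S \<alpha> k \<longleftrightarrow> (\<forall>c :: 'a ordinal set \<Rightarrow> colour.
    (\<exists>X \<subseteq> S. order_homeomorphic X \<alpha> \<and> (\<forall>e \<in> [X]\<^bsup>2\<^esup>. c e = Red)) \<or>
    (\<exists>Y \<in> [S]\<^bsup>k\<^esup>. \<forall>e \<in> [Y]\<^bsup>2\<^esup>. c e = Blue))"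

lemma arrowsE:
  assumes "arrows S \<alpha> k"
  obtains X where "X \<subseteq> S" "order_homeomorphic X \<alpha>" "\<And>e. e \<in> [X]\<^bsup>2\<^esup> \<Longrightarrow> c e = Red"
  | Y where "Y \<in> [S]\<^bsup>k\<^esup>" "\<And>e. e \<in> [Y]\<^bsup>2\<^esup> \<Longrightarrow> c e = Blue"
  using assms unfolding arrows_def by meson

lemma least_ordinal_eq_OrdD: "least_ordinal Q = Ord \<beta> \<Longrightarrow> Q \<beta>"
  unfolding least_ordinal_def by (auto split: if_splits intro: LeastI)

lemma least_ordinal_le: "Q \<beta> \<Longrightarrow> least_ordinal Q \<le> Ord \<beta>"
  unfolding least_ordinal_def by (auto intro: Least_le)

lemma Rcl_eq_OrdD: "Rcl \<alpha> k = Ord \<beta> \<Longrightarrow> arrows {..<\<beta>} \<alpha> k"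
  unfolding Rcl_def arrows_def by (drule least_ordinal_eq_OrdD)

lemma Rcl_le_Ord: "arrows {..<\<beta>} \<alpha> k \<Longrightarrow> Rcl \<alpha> k \<le> Ord \<beta>"
  unfolding Rcl_def arrows_def by (rule least_ordinal_le)

lemma Pcl_eq_OrdE:
  assumes "Pcl \<alpha>s = Ord \<beta>" and "\<And>\<delta>. \<delta> < \<beta> \<Longrightarrow> c \<delta> < length \<alpha>s"
  obtains i X where "i < length \<alpha>s" "X \<subseteq> {..<\<beta>}" "\<And>\<delta>. \<delta> \<in> X \<Longrightarrow> c \<delta> = i"
    "order_homeomorphic X (\<alpha>s ! i)"
proof -
  have "c \<in> {..<\<beta>} \<rightarrow> {..<length \<alpha>s}" using assms(2) by auto
  then obtain i X where "i < length \<alpha>s" "X \<subseteq> {\<delta> \<in> {..<\<beta>}. c \<delta> = i}" "order_homeomorphic X (\<alpha>s ! i)"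
    using least_ordinal_eq_OrdD[OF assms(1)[unfolded Pcl_def]] by blast
  then show ?thesis by (intro that) auto
qed

lemma nsets_2_imageE:
  assumes "e \<in> [g ` Z]\<^bsup>2\<^esup>"
  obtains d where "d \<in> [Z]\<^bsup>2\<^esup>" "e = g ` d"
proof -
  obtain u v where "u \<in> Z" "v \<in> Z" "g u \<noteq> g v" "e = {g u, g v}"
    using assms by (auto simp: nsets_2_eq)
  then show ?thesis by (intro that[of "{u, v}"]) auto
qed

text \<open>
  A colouring of the pairs of a closed copy of \<open>\<beta>\<close> is pulled back to \<open>\<beta>\<close> along the homeomorphism,
  and the homogeneous set found there is pushed forward.
\<close>

lemma arrows_closed_copy:
  assumes arr: "arrows {..<\<beta>} \<alpha> k" and X: "order_homeomorphic X \<beta>"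
  shows "arrows X \<alpha> k"
  unfolding arrows_def
proof
  fix c :: "'a ordinal set \<Rightarrow> colour"
  obtain f g where hom: "homeomorphism X {..<\<beta>} f g" and mono: "strict_mono_on X f"
    using X unfolding order_homeomorphic_def by blast
  have g_im: "g ` {..<\<beta>} = X" and fg: "\<And>y. y < \<beta> \<Longrightarrow> f (g y) = y"
    using hom unfolding homeomorphism_def by blast+
  then have inj: "inj_on g {..<\<beta>}" by (metis inj_on_inverseI lessThan_iff)
  show "(\<exists>X' \<subseteq> X. order_homeomorphic X' \<alpha> \<and> (\<forall>e \<in> [X']\<^bsup>2\<^esup>. c e = Red)) \<or>
    (\<exists>Y \<in> [X]\<^bsup>k\<^esup>. \<forall>e \<in> [Y]\<^bsup>2\<^esup>. c e = Blue)"
  proof (rule arrowsE[OF arr, of "\<lambda>e. c (g ` e)"])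
    fix Z assume Z: "Z \<subseteq> {..<\<beta>}" "order_homeomorphic Z \<alpha>" "\<And>e. e \<in> [Z]\<^bsup>2\<^esup> \<Longrightarrow> c (g ` e) = Red"
    obtain p q where pq: "homeomorphism Z {..<\<alpha>} p q" and p: "strict_mono_on Z p"
      using Z(2) unfolding order_homeomorphic_def by blast
    have sub: "g ` Z \<subseteq> X" using Z(1) g_im by blast
    have f_im: "f ` g ` Z = Z" using Z(1) fg by force
    have "homeomorphism (g ` Z) Z f g"
      using homeomorphism_of_subsets[OF hom sub subset_refl f_im] by simp
    then have "homeomorphism (g ` Z) {..<\<alpha>} (p \<circ> f) (g \<circ> q)"
      using pq by (rule homeomorphism_compose)
    moreover have "strict_mono_on (g ` Z) (p \<circ> f)"
    proof (rule strict_mono_onI)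
      fix u v assume uv: "u \<in> g ` Z" "v \<in> g ` Z" "u < v"
      then have "f u < f v" using mono sub by (meson strict_mono_onD subsetD)
      moreover have "f u \<in> Z" "f v \<in> Z" using uv f_im by blast+
      ultimately show "(p \<circ> f) u < (p \<circ> f) v" using strict_mono_onD[OF p, of "f u" "f v"] by simp
    qed
    ultimately have "order_homeomorphic (g ` Z) \<alpha>"
      unfolding order_homeomorphic_def by blast
    moreover have "c e = Red" if "e \<in> [g ` Z]\<^bsup>2\<^esup>" for e
      using nsets_2_imageE[OF that] Z(3) by metis
    ultimately show ?thesis using sub by blast
  next
    fix Y assume Y: "Y \<in> [{..<\<beta>}]\<^bsup>k\<^esup>" "\<And>e. e \<in> [Y]\<^bsup>2\<^esup> \<Longrightarrow> c (g ` e) = Blue"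
    have Y_sub: "Y \<subseteq> {..<\<beta>}" using Y(1) by (simp add: nsets_def)
    then have "g ` Y \<in> [X]\<^bsup>k\<^esup>"
      using Y(1) g_im inj_on_subset[OF inj Y_sub] by (auto simp: nsets_def card_image)
    moreover have "c e = Blue" if "e \<in> [g ` Y]\<^bsup>2\<^esup>" for e
      using nsets_2_imageE[OF that] Y(2) by metis
    ultimately show ?thesis by blast
  qed
qed

lemma nsets_2_insertD:
  assumes "e \<in> [insert y Z]\<^bsup>2\<^esup>"
  shows "e \<in> [Z]\<^bsup>2\<^esup> \<or> (\<exists>x \<in> Z. e = {x, y})"
  using assms by (auto simp: nsets_2_eq insert_commute)

text \<open>
  A vertex \<open>y\<close> above \<open>S\<close> and red to all of \<open>S\<close> raises the red target by one; dually, a vertex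
  blue to a blue clique enlarges it by one.
  These are the closed analogues of the two steps in the recursive proof of Ramsey's theorem.
\<close>

lemma red_cone:
  fixes \<alpha> :: "'a::infinite ordinal"
  assumes suc: "successor_ordinal \<alpha>" and arr: "arrows S \<alpha> k" and top: "S \<subseteq> {..<y}"
    and red: "\<And>x. x \<in> S \<Longrightarrow> c {x, y} = Red" and T: "insert y S \<subseteq> T"
  shows "(\<exists>X \<subseteq> T. order_homeomorphic X (\<alpha> + 1) \<and> (\<forall>e \<in> [X]\<^bsup>2\<^esup>. c e = Red)) \<or>
    (\<exists>Y \<in> [T]\<^bsup>k\<^esup>. \<forall>e \<in> [Y]\<^bsup>2\<^esup>. c e = Blue)"
proof (rule arrowsE[OF arr, of c])
  fix Z assume Z: "Z \<subseteq> S" "order_homeomorphic Z \<alpha>" "\<And>e. e \<in> [Z]\<^bsup>2\<^esup> \<Longrightarrow> c e = Red"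
  have "Z \<subseteq> {..<y}" using Z(1) top by (rule order_trans)
  then have "order_homeomorphic (insert y Z) (\<alpha> + 1)"
    by (rule order_homeomorphic_insert_top[OF suc Z(2)])
  moreover have "c e = Red" if "e \<in> [insert y Z]\<^bsup>2\<^esup>" for e
    using nsets_2_insertD[OF that] Z(1,3) red by blast
  moreover have "insert y Z \<subseteq> T" using Z(1) T by blast
  ultimately show ?thesis by blast
next
  fix Y assume Y: "Y \<in> [S]\<^bsup>k\<^esup>" "\<And>e. e \<in> [Y]\<^bsup>2\<^esup> \<Longrightarrow> c e = Blue"
  moreover have "S \<subseteq> T" using T by blast
  ultimately have "Y \<in> [T]\<^bsup>k\<^esup>" using nsets_mono by blast
  then show ?thesis using Y(2) by blast
qed

lemma blue_clique_insert:
  assumes Y: "Y \<in> [S]\<^bsup>k\<^esup>" "\<And>e. e \<in> [Y]\<^bsup>2\<^esup> \<Longrightarrow> c e = Blue" and y: "y \<notin> Y"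
    and blue: "\<And>x. x \<in> Y \<Longrightarrow> c {x, y} = Blue" and T: "insert y S \<subseteq> T"
  shows "\<exists>Y' \<in> [T]\<^bsup>(k + 1)\<^esup>. \<forall>e \<in> [Y']\<^bsup>2\<^esup>. c e = Blue"
proof (intro bexI ballI)
  show "insert y Y \<in> [T]\<^bsup>(k + 1)\<^esup>"
    using Y(1) y T by (auto simp: nsets_def)
  show "c e = Blue" if "e \<in> [insert y Y]\<^bsup>2\<^esup>" for e
    using nsets_2_insertD[OF that] Y(2) blue by blast
qed

section \<open>The two recursive bounds\<close>

lemma arrows_pigeonhole_succ:
  fixes \<alpha> :: "'a::infinite ordinal"
  assumes suc: "successor_ordinal \<alpha>"
    and \<rho>: "arrows {..<\<rho>} \<alpha> (k + 1)" and \<sigma>: "arrows {..<\<sigma>} (\<alpha> + 1) k"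
    and P: "Pcl [\<rho>, \<sigma>] = Ord P"
  shows "arrows {..<P + 1} (\<alpha> + 1) (k + 1)"
  unfolding arrows_def
proof
  fix c :: "'a ordinal set \<Rightarrow> colour"
  let ?goal = "(\<exists>X \<subseteq> {..<P + 1}. order_homeomorphic X (\<alpha> + 1) \<and> (\<forall>e \<in> [X]\<^bsup>2\<^esup>. c e = Red)) \<or>
    (\<exists>Y \<in> [{..<P + 1}]\<^bsup>(k + 1)\<^esup>. \<forall>e \<in> [Y]\<^bsup>2\<^esup>. c e = Blue)"
  define d where "d \<delta> = (if c {\<delta>, P} = Red then 0 else 1 :: nat)" for \<delta>
  obtain i X where i: "i < length [\<rho>, \<sigma>]" and X: "X \<subseteq> {..<P}" and d: "\<And>\<delta>. \<delta> \<in> X \<Longrightarrow> d \<delta> = i"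
    and hom: "order_homeomorphic X ([\<rho>, \<sigma>] ! i)"
    by (rule Pcl_eq_OrdE[OF P, of d]) (auto simp: d_def)
  have sub: "insert P X \<subseteq> {..<P + 1}" using X by (auto simp: lessThan_ordinal_succ)
  consider "i = 0" | "i = 1" using i by fastforce
  then show ?goal
  proof cases
    case 1
    then have "arrows X \<alpha> (k + 1)" using arrows_closed_copy[OF \<rho>] hom by simp
    moreover have "c {x, P} = Red" if "x \<in> X" for x
      using d[OF that] 1 by (simp add: d_def split: if_splits)
    ultimately show ?thesis
      by (intro red_cone[OF suc _ X _ sub])
  next
    case 2
    then have arr: "arrows X (\<alpha> + 1) k" using arrows_closed_copy[OF \<sigma>] hom by simp
    have blue: "c {x, P} = Blue" if "x \<in> X" for x
      using d[OF that] 2 by (cases "c {x, P}") (simp_all add: d_def)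
    show ?thesis
    proof (rule arrowsE[OF arr, of c])
      fix Y assume Y: "Y \<in> [X]\<^bsup>k\<^esup>" "\<And>e. e \<in> [Y]\<^bsup>2\<^esup> \<Longrightarrow> c e = Blue"
      have "Y \<subseteq> X" using Y(1) by (simp add: nsets_def)
      then have "\<exists>Y' \<in> [{..<P + 1}]\<^bsup>(k + 1)\<^esup>. \<forall>e \<in> [Y']\<^bsup>2\<^esup>. c e = Blue"
        using X blue by (intro blue_clique_insert[OF Y _ _ sub]) blast+
      then show ?thesis ..
    next
      fix Z assume "Z \<subseteq> X" "order_homeomorphic Z (\<alpha> + 1)" "\<And>e. e \<in> [Z]\<^bsup>2\<^esup> \<Longrightarrow> c e = Red"
      then show ?thesis using sub by blast
    qed
  qed
qed

lemma arrows_pigeonhole_plus: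
  fixes \<alpha> :: "'a::infinite ordinal"
  assumes suc: "successor_ordinal \<alpha>"
    and \<rho>: "arrows {..<\<rho>} \<alpha> (k + 1)" and \<sigma>: "arrows {..<\<sigma>} (\<alpha> + 1) k"
    and P: "Pcl (replicate k \<rho>) = Ord P"
  shows "arrows {..<P + \<sigma>} (\<alpha> + 1) (k + 1)"
  unfolding arrows_def
proof
  fix c :: "'a ordinal set \<Rightarrow> colour"
  let ?goal = "(\<exists>X \<subseteq> {..<P + \<sigma>}. order_homeomorphic X (\<alpha> + 1) \<and> (\<forall>e \<in> [X]\<^bsup>2\<^esup>. c e = Red)) \<or>
    (\<exists>Y \<in> [{..<P + \<sigma>}]\<^bsup>(k + 1)\<^esup>. \<forall>e \<in> [Y]\<^bsup>2\<^esup>. c e = Blue)"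
  have "P \<le> P + \<sigma>" using tail_of_ordinal_sum by metis
  have tail: "arrows {P..<P + \<sigma>} (\<alpha> + 1) k"
    using arrows_closed_copy[OF \<sigma> order_homeomorphic_tail] .
  show ?goal
  proof (rule arrowsE[OF tail, of c])
    fix Z assume "Z \<subseteq> {P..<P + \<sigma>}" "order_homeomorphic Z (\<alpha> + 1)" "\<And>e. e \<in> [Z]\<^bsup>2\<^esup> \<Longrightarrow> c e = Red"
    moreover have "{P..<P + \<sigma>} \<subseteq> {..<P + \<sigma>}" by auto
    ultimately show ?thesis by blast
  next
    fix Y assume Y: "Y \<in> [{P..<P + \<sigma>}]\<^bsup>k\<^esup>" "\<And>e. e \<in> [Y]\<^bsup>2\<^esup> \<Longrightarrow> c e = Blue"
    have Y_sub: "Y \<subseteq> {P..<P + \<sigma>}" and "finite Y" "card Y = k" using Y(1) by (auto simp: nsets_def)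
    then obtain y where "bij_betw y {0..<k} Y" using ex_bij_betw_nat_finite by blast
    then have y: "y ` {..<k} = Y" by (simp add: bij_betw_def lessThan_atLeast0)
    show ?thesis
    proof (cases "\<exists>\<delta> < P. \<forall>x \<in> Y. c {x, \<delta>} = Blue")
      case True
      then obtain \<delta> where \<delta>: "\<delta> < P" "\<And>x. x \<in> Y \<Longrightarrow> c {x, \<delta>} = Blue" by blast
      have "insert \<delta> {P..<P + \<sigma>} \<subseteq> {..<P + \<sigma>}" using \<delta>(1) \<open>P \<le> P + \<sigma>\<close> by auto
      moreover have "\<delta> \<notin> Y" using \<delta>(1) Y_sub by (meson atLeastLessThan_iff leD subsetD)
      ultimately have "\<exists>Y' \<in> [{..<P + \<sigma>}]\<^bsup>(k + 1)\<^esup>. \<forall>e \<in> [Y']\<^bsup>2\<^esup>. c e = Blue"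
        using \<delta>(2) by (intro blue_clique_insert[OF Y])
      then show ?thesis ..
    next
      case False
      \<comment> \<open>Each point below \<open>P\<close> chooses a vertex of \<open>Y\<close> to which it is red.\<close>
      define d where "d \<delta> = (SOME i. i < k \<and> c {\<delta>, y i} = Red)" for \<delta>
      have d: "d \<delta> < k \<and> c {\<delta>, y (d \<delta>)} = Red" if "\<delta> < P" for \<delta>
      proof -
        obtain x where "x \<in> Y" "c {x, \<delta>} \<noteq> Blue" using False \<open>\<delta> < P\<close> by blast
        then obtain i where "i < k" "x = y i" using y by blast
        moreover have "c {x, \<delta>} = Red" using \<open>c {x, \<delta>} \<noteq> Blue\<close> by (cases "c {x, \<delta>}") simp_all
        ultimately have "\<exists>i. i < k \<and> c {\<delta>, y i} = Red" by (auto simp: insert_commute)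
        then show ?thesis unfolding d_def by (rule someI_ex)
      qed
      obtain i X where i: "i < k" and X: "X \<subseteq> {..<P}" and di: "\<And>\<delta>. \<delta> \<in> X \<Longrightarrow> d \<delta> = i"
        and hom: "order_homeomorphic X (replicate k \<rho> ! i)"
        by (rule Pcl_eq_OrdE[OF P, of d]) (use d in auto)
      have arr: "arrows X \<alpha> (k + 1)" using arrows_closed_copy[OF \<rho>] hom i by simp
      have yi: "y i \<in> {P..<P + \<sigma>}" using y i Y_sub by blast
      have top: "X \<subseteq> {..<y i}" using X yi by auto
      have red: "c {x, y i} = Red" if "x \<in> X" for x
        using d[of x] di[OF that] X that by auto
      have "insert (y i) X \<subseteq> {..<P + \<sigma>}" using X yi \<open>P \<le> P + \<sigma>\<close> by auto
      with red show ?thesis by (rule red_cone[OF suc arr top])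
    qed
  qed
qed

theorem proposition5p1:
  fixes \<alpha> :: "'a::infinite ordinal" and k :: nat
  assumes "successor_ordinal \<alpha>" and "k \<ge> 2"
  shows "Rcl (\<alpha> + 1) (k + 1) \<le> Pcl_ext [Rcl \<alpha> (k + 1), Rcl (\<alpha> + 1) k] + 1 \<and>
         Rcl (\<alpha> + 1) (k + 1) \<le> Pcl_const (Rcl \<alpha> (k + 1)) k + Rcl (\<alpha> + 1) k"
proof (cases "Rcl \<alpha> (k + 1) = \<infinity>\<^sub>o \<or> Rcl (\<alpha> + 1) k = \<infinity>\<^sub>o")
  case True
  \<comment> \<open>Both right-hand sides are infinite. For the replicated list this uses that it is nonempty.\<close>
  moreover have "x + \<infinity>\<^sub>o = \<infinity>\<^sub>o" for x :: "'a ext_ordinal" by (cases x) auto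
  ultimately show ?thesis using \<open>k \<ge> 2\<close> by (auto simp: Pcl_ext_def)
next
  case False
  then obtain \<rho> \<sigma> where R: "Rcl \<alpha> (k + 1) = Ord \<rho>" "Rcl (\<alpha> + 1) k = Ord \<sigma>"
    by (metis ext_ordinal.exhaust)
  note arr = Rcl_eq_OrdD[OF R(1)] Rcl_eq_OrdD[OF R(2)]
  have "Rcl (\<alpha> + 1) (k + 1) \<le> Pcl [\<rho>, \<sigma>] + 1"
  proof (cases "Pcl [\<rho>, \<sigma>]")
    case (Ord P)
    then show ?thesis
      using Rcl_le_Ord[OF arrows_pigeonhole_succ[OF assms(1) arr]] by (simp add: one_ext_ordinal_def)
  qed simp
  moreover have "Rcl (\<alpha> + 1) (k + 1) \<le> Pcl (replicate k \<rho>) + Ord \<sigma>"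
  proof (cases "Pcl (replicate k \<rho>)")
    case (Ord P)
    then show ?thesis
      using Rcl_le_Ord[OF arrows_pigeonhole_plus[OF assms(1) arr]] by simp
  qed simp
  ultimately show ?thesis unfolding R Pcl_ext_def by simp
qed

end
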